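(* Let $R$ be a region (without defects) consisting of $n$ cells. Then the region $R^{\boxplus}$ has a cover by L-trominoes if and only if $3\mid n$.
   Context: A cell is a unit square $[i,i+1]\times[j,j+1]$ with $i,j\in\mathbb{Z}$, labelled $(i,j)$. A region is a finite set of cells whose union is connected (equivalently, whose graph with edges between cells $(i,j),(i',j')$ with $|i-i'|+|j-j'|=1$ is connected). An L-tromino is a set of three cells equal to a $2\times 2$ block of cells with one cell removed (any of the four orientations). A cover of a region is a partition of it into L-trominoes. For a region $R$, $R^{\boxplus}$ is the region obtained by subdividing each cell into four cells, i.e. $R^{\boxplus}=\{(2i+s,2j+t): (i,j)\in R,\ s,t\in\{0,1\}\}$. *)

theory Defs
  imports Main
begin

type_synonym cell = "int \<times> int"

definition adjacent :: "cell \<Rightarrow> cell \<Rightarrow> bool" where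
  "adjacent c d \<longleftrightarrow> \<bar>fst c - fst d\<bar> + \<bar>snd c - snd d\<bar> = 1"

definition region :: "cell set \<Rightarrow> bool" where
  "region R \<longleftrightarrow> finite R \<and>
     (\<forall>c\<in>R. \<forall>d\<in>R. (\<lambda>x y. x \<in> R \<and> y \<in> R \<and> adjacent x y)\<^sup>*\<^sup>* c d)"

definition block :: "int \<Rightarrow> int \<Rightarrow> cell set" where
  "block i j = {(i,j), (i+1,j), (i,j+1), (i+1,j+1)}"

definition L_tromino :: "cell set \<Rightarrow> bool" where
  "L_tromino T \<longleftrightarrow> (\<exists>i j c. c \<in> block i j \<and> T = block i j - {c})"

definition is_cover :: "cell set set \<Rightarrow> cell set \<Rightarrow> bool" where
  "is_cover P R \<longleftrightarrow> (\<forall>T\<in>P. L_tromino T) \<and> \<Union>P = R \<and>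
     (\<forall>T\<in>P. \<forall>T'\<in>P. T \<noteq> T' \<longrightarrow> T \<inter> T' = {})"

definition has_cover :: "cell set \<Rightarrow> bool" where
  "has_cover R \<longleftrightarrow> (\<exists>P. is_cover P R)"

definition subdivide :: "cell set \<Rightarrow> cell set" where
  "subdivide R = {(2*i+s, 2*j+t) | i j s t. (i,j) \<in> R \<and> s \<in> {0,1} \<and> t \<in> {0,1}}"

end

(*
  Give the cells of R their distance d from a leftmost cell. A set S in which every cell descends
  to a root v, with the parent v + e outside S, is handled by induction on its size: according to
  card S mod 3, its subdivision can be covered exactly, up to a cell of the block of v bordering the
  parent, or together with a cell of the parent bordering v. For either exchanged cell there are two
  candidates; both work unless one of the neighbours v + f, v - f lies in S, and then the candidate
  on that side works for an added cell, the opposite one for a cell left over.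

  To prove this for S, the cells other than v are distributed to the back v - e and the two sides
  v + f, v - f. Only cells descending through a diagonal cell v - e + f or v - e - f with both
  neighbours in S give trouble, since they restrict the exchanges of whatever they are added to;
  they may go to the side or to the back, or a tromino around the common corner of the three blocks
  completes the cover of all of them. A finite check modulo 3 shows that some choice always works.
*)

theory Submission
  imports Defs "HOL-Library.Product_Plus"
begin

section \<open>Covers\<close>

lemma has_cover_empty [simp]: "has_cover {}"
  unfolding has_cover_def is_cover_def by (intro exI[of _ "{}"]) auto

lemma has_cover_tromino: "L_tromino T \<Longrightarrow> has_cover T"
  unfolding has_cover_def is_cover_def by (intro exI[of _ "{T}"]) auto

lemma has_cover_Un:
  assumes "has_cover A" "has_cover B" "A \<inter> B = {}"
  shows "has_cover (A \<union> B)"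
proof -
  obtain P Q where P: "is_cover P A" and Q: "is_cover Q B"
    using assms by (auto simp: has_cover_def)
  have "T \<inter> T' = {}" if "T \<in> P" "T' \<in> Q" for T T'
    using that assms(3) P Q unfolding is_cover_def by blast
  then have "is_cover (P \<union> Q) (A \<union> B)"
    using P Q unfolding is_cover_def by (simp add: ball_Un) (metis Int_commute)
  then show ?thesis
    by (auto simp: has_cover_def)
qed

lemma card_block: "card (block i j) = 4"
  by (simp add: block_def)

lemma L_tromino_card:
  assumes "L_tromino T"
  shows "finite T" "card T = 3"
proof -
  obtain i j c where T: "c \<in> block i j" "T = block i j - {c}"
    using assms by (auto simp: L_tromino_def)
  have fin: "finite (block i j)"
    by (simp add: block_def)
  show "finite T"
    using T fin by simp
  show "card T = 3"
    using T fin by (simp add: card_Diff_singleton card_block)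
qed

lemma has_cover_dvd_card:
  assumes "has_cover A" "finite A"
  shows "3 dvd card A"
proof -
  obtain P where P: "is_cover P A"
    using assms by (auto simp: has_cover_def)
  have "card (\<Union>P) = sum card P"
    using P by (intro card_Union_disjoint) (auto simp: is_cover_def pairwise_def disjnt_def dest: L_tromino_card)
  also have "\<dots> = (\<Sum>T\<in>P. 3)"
    using P by (intro sum.cong) (auto simp: is_cover_def dest: L_tromino_card)
  finally show ?thesis
    using P by (simp add: is_cover_def)
qed

text \<open>An executable certificate: a tuple names a 2 by 2 block and the offset of its missing
  cell. Taking each tromino out of the remaining set makes disjointness automatic.\<close>

fun tiles :: "(int \<times> int \<times> int \<times> int) list \<Rightarrow> cell set \<Rightarrow> bool" where
  "tiles [] X \<longleftrightarrow> X = {}"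
| "tiles ((i, j, a, b) # ts) X \<longleftrightarrow> a \<in> {0, 1} \<and> b \<in> {0, 1} \<and>
     block i j - {(i + a, j + b)} \<subseteq> X \<and> tiles ts (X - (block i j - {(i + a, j + b)}))"

lemma L_tromino_block_Diff:
  assumes "a \<in> {0, 1}" "b \<in> {0, 1}"
  shows "L_tromino (block i j - {(i + a, j + b)})"
proof -
  have "(i + a, j + b) \<in> block i j"
    using assms by (auto simp: block_def)
  then show ?thesis
    unfolding L_tromino_def by blast
qed

lemma has_cover_tiles: "tiles ts X \<Longrightarrow> has_cover X"
proof (induction ts arbitrary: X)
  case (Cons t ts)
  obtain i j a b where t: "t = (i, j, a, b)"
    by (cases t)
  define T where "T = block i j - {(i + a, j + b)}"
  have T: "L_tromino T" "T \<subseteq> X" "tiles ts (X - T)"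
    using Cons.prems L_tromino_block_Diff[of a b i j] by (simp_all add: t T_def)
  have "has_cover (T \<union> (X - T))"
    using T Cons.IH by (intro has_cover_Un) (auto intro: has_cover_tromino)
  then show ?case
    using T(2) by (simp add: Un_absorb1)
qed simp

section \<open>Subdivision and local coordinates\<close>

lemma mem_subdivide: "p \<in> subdivide R \<longleftrightarrow> (fst p div 2, snd p div 2) \<in> R"
proof
  assume "(fst p div 2, snd p div 2) \<in> R"
  then show "p \<in> subdivide R"
    unfolding subdivide_def mem_Collect_eq
    by (intro exI[of _ "fst p div 2"] exI[of _ "snd p div 2"] exI[of _ "fst p mod 2"]
        exI[of _ "snd p mod 2"]) (auto simp: prod_eq_iff)
qed (auto simp: subdivide_def)

lemma subdivide_empty [simp]: "subdivide {} = {}"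
  and subdivide_Un: "subdivide (A \<union> B) = subdivide A \<union> subdivide B"
  and subdivide_Int: "subdivide (A \<inter> B) = subdivide A \<inter> subdivide B"
  by (auto simp: mem_subdivide)

lemma subdivide_disjoint: "A \<inter> B = {} \<Longrightarrow> subdivide A \<inter> subdivide B = {}"
  by (metis subdivide_Int subdivide_empty)

lemma subdivide_single: "subdivide {(i, j)} = block (2 * i) (2 * j)"
  unfolding subdivide_def block_def by auto

lemma card_subdivide:
  assumes "finite R"
  shows "finite (subdivide R) \<and> card (subdivide R) = 4 * card R"
  using assms
proof (induction rule: finite_induct)
  case (insert c R)
  obtain i j where c: "c = (i, j)" by fastforce
  have "subdivide (insert c R) = block (2 * i) (2 * j) \<union> subdivide R"
    using subdivide_Un[of "{c}" R] by (simp add: c subdivide_single)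
  moreover have "block (2 * i) (2 * j) \<inter> subdivide R = {}"
    using subdivide_disjoint[of "{c}" R] insert.hyps by (simp add: c subdivide_single)
  moreover have "finite (block (2 * i) (2 * j))"
    by (simp add: block_def)
  ultimately show ?case
    using insert by (simp add: card_Un_disjoint card_block)
qed auto

section \<open>Frames of the subdivided plane and their symmetries\<close>

definition perp :: "cell \<Rightarrow> cell \<Rightarrow> bool" where
  "perp e f \<longleftrightarrow> (e, f) \<in> {(1, 0), (-1, 0)} \<times> {(0, 1), (0, -1)} \<union> {(0, 1), (0, -1)} \<times> {(1, 0), (-1, 0)}"

lemma perp_cases:
  assumes "perp e f"
  obtains "e = (1, 0)" "f = (0, 1)" | "e = (1, 0)" "f = (0, -1)"
    | "e = (-1, 0)" "f = (0, 1)" | "e = (-1, 0)" "f = (0, -1)"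
    | "e = (0, 1)" "f = (1, 0)" | "e = (0, 1)" "f = (-1, 0)"
    | "e = (0, -1)" "f = (1, 0)" | "e = (0, -1)" "f = (-1, 0)"
  using assms unfolding perp_def by auto

lemma perp_simps [simp]: "perp e (- f) = perp e f" "perp (- e) f = perp e f"
  unfolding perp_def by (auto simp: prod_eq_iff)

lemma perp_sym: "perp e f = perp f e"
  unfolding perp_def by auto

text \<open>Cells of the subdivided plane in the frame in which the block of \<open>v\<close> is \<open>{0, 1} \<times> {0, 1}\<close>,
  the first axis points along \<open>e\<close> and the second one along \<open>f\<close>.\<close>

definition loc :: "cell \<Rightarrow> cell \<Rightarrow> cell \<Rightarrow> cell \<Rightarrow> cell" where
  "loc v e f p =
     (2 * fst v + (1 - fst e - fst f) div 2 + fst p * fst e + snd p * fst f,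
      2 * snd v + (1 - snd e - snd f) div 2 + fst p * snd e + snd p * snd f)"

lemma inj_loc: "perp e f \<Longrightarrow> inj (loc v e f)"
  by (erule perp_cases) (auto simp: inj_def loc_def)

lemma loc_swap: "loc v f e (x, y) = loc v e f (y, x)"
  by (simp add: loc_def algebra_simps)

lemma loc_minus1: "perp e f \<Longrightarrow> loc v (- e) f (x, y) = loc v e f (1 - x, y)"
  by (erule perp_cases) (auto simp: loc_def)

lemma loc_minus2: "perp e f \<Longrightarrow> loc v e (- f) (x, y) = loc v e f (x, 1 - y)"
  by (erule perp_cases) (auto simp: loc_def)

lemma loc_add:
  "loc (v + e) e f (x, y) = loc v e f (x + 2, y)" "loc (v - e) e f (x, y) = loc v e f (x - 2, y)"
  "loc (v + f) e f (x, y) = loc v e f (x, y + 2)" "loc (v - f) e f (x, y) = loc v e f (x, y - 2)"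
  by (simp_all add: loc_def algebra_simps)

lemma loc_block: "perp e f \<Longrightarrow> loc v e f ` ({0, 1} \<times> {0, 1}) = subdivide {v}"
  by (cases v; erule perp_cases) (auto simp: loc_def subdivide_single block_def)

lemma loc_mem:
  assumes "perp e f" "fst p \<in> {0, 1}" "snd p \<in> {0, 1}" "v \<in> K"
  shows "loc v e f p \<in> subdivide K"
proof -
  have "loc v e f p \<in> subdivide {v}"
    using assms(2,3) loc_block[OF assms(1), of v] by (cases p) auto
  then show ?thesis
    using assms(4) by (auto simp: mem_subdivide)
qed

text \<open>A change of frame is a symmetry of the square grid. Reversing an axis sends the
  coordinates j and j + 1 to 1 - j and -j, so the lower corner moves to -j without a further
  shift.\<close>

lemma loc_image_block:
  assumes "perp e f"
  shows "\<exists>i' j'. loc v e f ` block i j = block i' j'"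
  using assms
proof (cases rule: perp_cases)
  case 1
  then have "loc v e f ` block i j = block (2 * fst v + i) (2 * snd v + j)"
    by (auto simp: loc_def block_def)
  then show ?thesis by blast
next
  case 2
  then have "loc v e f ` block i j = block (2 * fst v + i) (2 * snd v - j)"
    by (auto simp: loc_def block_def)
  then show ?thesis by blast
next
  case 3
  then have "loc v e f ` block i j = block (2 * fst v - i) (2 * snd v + j)"
    by (auto simp: loc_def block_def)
  then show ?thesis by blast
next
  case 4
  then have "loc v e f ` block i j = block (2 * fst v - i) (2 * snd v - j)"
    by (auto simp: loc_def block_def)
  then show ?thesis by blast
next
  case 5
  then have "loc v e f ` block i j = block (2 * fst v + j) (2 * snd v + i)"
    by (auto simp: loc_def block_def)
  then show ?thesis by blast
next
  case 6
  then have "loc v e f ` block i j = block (2 * fst v - j) (2 * snd v + i)"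
    by (auto simp: loc_def block_def)
  then show ?thesis by blast
next
  case 7
  then have "loc v e f ` block i j = block (2 * fst v + j) (2 * snd v - i)"
    by (auto simp: loc_def block_def)
  then show ?thesis by blast
next
  case 8
  then have "loc v e f ` block i j = block (2 * fst v - j) (2 * snd v - i)"
    by (auto simp: loc_def block_def)
  then show ?thesis by blast
qed

lemma L_tromino_loc:
  assumes "perp e f" "L_tromino T"
  shows "L_tromino (loc v e f ` T)"
proof -
  obtain i j c where T: "c \<in> block i j" "T = block i j - {c}"
    using assms(2) by (auto simp: L_tromino_def)
  obtain i' j' where "loc v e f ` block i j = block i' j'"
    using loc_image_block[OF assms(1)] by blast
  then have "loc v e f c \<in> block i' j'" "loc v e f ` T = block i' j' - {loc v e f c}"
    using T(1) image_set_diff[OF inj_loc[OF assms(1), of v], of "block i j" "{c}"] by (auto simp: T(2))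
  then show ?thesis
    unfolding L_tromino_def by blast
qed

lemma has_cover_loc:
  assumes "perp e f" "has_cover A"
  shows "has_cover (loc v e f ` A)"
proof -
  obtain P where P: "is_cover P A"
    using assms by (auto simp: has_cover_def)
  have "L_tromino (loc v e f ` T)" if "T \<in> P" for T
    using that P L_tromino_loc[OF assms(1)] by (simp add: is_cover_def)
  moreover have "loc v e f ` T \<inter> loc v e f ` T' = {}" if "T \<in> P" "T' \<in> P" "T \<noteq> T'" for T T'
    using that P image_Int[OF inj_loc[OF assms(1), of v], of T T'] by (simp add: is_cover_def)
  moreover have "(\<Union>T\<in>P. loc v e f ` T) = loc v e f ` A"
    using P by (auto simp: is_cover_def)
  ultimately have "is_cover ((`) (loc v e f) ` P) (loc v e f ` A)"
    unfolding is_cover_def by blast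
  then show ?thesis
    by (auto simp: has_cover_def)
qed

section \<open>Attaching subregions to a block\<close>

text \<open>Subdividing multiplies sizes by 4, which is 1 modulo 3: residue 1 means one cell too
  many, residue 2 one too few. A set that may be empty treats the three residues uniformly.\<close>

definition pick :: "nat \<Rightarrow> cell \<Rightarrow> nat \<Rightarrow> cell set" where
  "pick k p n = (if n mod 3 = k then {p} else {})"

text \<open>\<open>K\<close> is thought of as hanging from its cell \<open>u\<close>, with parent \<open>u + a\<close>. According to the size of
  \<open>K\<close> modulo 3, its subdivision can be covered exactly, up to a cell on the side of the parent
  left to the parent, or together with a cell of the parent; the sign of \<open>h\<close> determines which of
  the two cells is meant.\<close>

definition fits :: "cell set \<Rightarrow> cell \<Rightarrow> cell \<Rightarrow> cell \<Rightarrow> bool" where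
  "fits K u a h \<longleftrightarrow> (K = {} \<or> u \<in> K) \<and>
     has_cover (subdivide K - loc u a h ` pick 1 (1, 0) (card K) \<union> loc u a h ` pick 2 (2, 1) (card K))"

lemma fits_empty [simp]: "fits {} u a h"
  by (simp add: fits_def pick_def)

text \<open>The same for a subregion \<open>K\<close> seen from a neighbouring block with local frame \<open>q\<close>:
  \<open>z\<close> is the cell left over and \<open>y\<close> the additional cell.\<close>

definition fits_at :: "(cell \<Rightarrow> cell) \<Rightarrow> cell set \<Rightarrow> cell \<Rightarrow> cell \<Rightarrow> bool" where
  "fits_at q K z y \<longleftrightarrow> q ` pick 1 z (card K) \<subseteq> subdivide K \<and>
     has_cover (subdivide K - q ` pick 1 z (card K) \<union> q ` pick 2 y (card K))"

lemma fits_imp_fits_at: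
  assumes "fits K u a h" "perp a h" "loc u a h (1, 0) = q z" "loc u a h (2, 1) = q y"
  shows "fits_at q K z y"
  using assms loc_mem[of a h "(1, 0)" u K] unfolding fits_def fits_at_def pick_def by auto

lemma fits_at_back:
  assumes "perp e f" "fits K (v - e) e (if b then f else - f)"
  shows "fits_at (loc v e f) K (-1, if b then 0 else 1) (0, if b then 1 else 0)"
  using assms
  by (intro fits_imp_fits_at[OF assms(2)]) (auto simp: loc_minus2 loc_add)

text \<open>The axes swap roles: the parent lies in direction \<open>- f\<close> and the sign refers
  to \<open>e\<close>. With \<open>b\<close> true the additional cell is at the back, away from
  \<open>v + e\<close>, and the cell left over is on the front side.\<close>

lemma fits_at_side:
  assumes "perp e f" "fits K (v + f) (- f) (if b then - e else e)"
  shows "fits_at (loc v e f) K (if b then 1 else 0, 2) (if b then 0 else 1, 1)"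
  using assms
  by (intro fits_imp_fits_at[OF assms(2)])
    (auto simp: loc_swap[of _ "- f"] loc_minus1 loc_minus2 loc_add perp_sym[of f])

lemma fits_at_other_side:
  assumes "perp e f" "fits K (v - f) f (if b then - e else e)"
  shows "fits_at (loc v e f) K (if b then 1 else 0, -1) (if b then 0 else 1, 0)"
  using assms
  by (intro fits_imp_fits_at[OF assms(2)])
    (auto simp: loc_swap[of _ f] loc_minus1 loc_add perp_sym[of f])

text \<open>A row lists the sizes modulo 3 of the subregions hanging from the back \<open>v - e\<close> and the sides
  \<open>v + f\<close> and \<open>v - f\<close> of a block \<open>v\<close>, then for each of them which of the two cells is exchanged
  with the block, and finally the trominoes meeting the block, in the format of \<open>tiles\<close>.\<close>

definition table :: "((nat \<times> nat \<times> nat) \<times> (bool \<times> bool \<times> bool) \<times> (int \<times> int \<times> int \<times> int) list) list" where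
  "table =
   [((0, 0, 0), (False, True, True), [(0, 0, 1, 0)]),
    ((0, 0, 0), (True, True, True), [(0, 0, 1, 0)]),
    ((0, 0, 2), (False, True, True), [(0, 0, 0, 0)]),
    ((0, 0, 2), (True, True, True), [(0, 0, 0, 0)]),
    ((0, 1, 0), (False, True, True), [(0, 0, 1, 1), (1, 1, 1, 1)]),
    ((0, 1, 0), (True, True, True), [(0, 0, 1, 1), (1, 1, 1, 1)]),
    ((0, 1, 1), (False, True, True), [(0, -1, 0, 0), (0, 1, 0, 1)]),
    ((0, 1, 1), (True, True, True), [(0, -1, 0, 0), (0, 1, 0, 1)]),
    ((0, 1, 2), (False, True, True), [(0, 1, 0, 1)]),
    ((0, 1, 2), (True, True, True), [(0, 1, 0, 1)]),
    ((0, 2, 0), (False, True, True), [(0, 0, 0, 1)]),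
    ((0, 2, 0), (True, True, True), [(0, 0, 0, 1)]),
    ((0, 2, 2), (False, True, True), [(1, 0, 1, 0)]),
    ((0, 2, 2), (True, True, True), [(1, 0, 1, 0)]),
    ((1, 0, 0), (True, True, True), [(-1, 0, 0, 1), (1, 0, 1, 0)]),
    ((1, 0, 0), (False, True, True), [(-1, 0, 0, 0), (1, 0, 1, 0)]),
    ((1, 0, 1), (True, True, False), [(-1, -1, 0, 0), (0, 0, 0, 0)]),
    ((1, 1, 0), (False, False, True), [(-1, 1, 0, 1), (0, 0, 0, 1)]),
    ((1, 1, 1), (True, True, False), [(-1, -1, 0, 0), (0, 1, 0, 1)]),
    ((1, 1, 2), (True, True, False), [(-1, 0, 0, 1), (1, 1, 1, 1)]),
    ((1, 1, 2), (False, True, False), [(-1, 0, 0, 0), (1, 1, 1, 1)]),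
    ((1, 1, 2), (False, False, True), [(-1, 1, 0, 1), (1, 0, 1, 0)]),
    ((1, 2, 0), (True, False, True), [(-1, 0, 0, 1)]),
    ((1, 2, 0), (False, False, True), [(-1, 0, 0, 0)]),
    ((1, 2, 1), (True, True, False), [(-1, -1, 0, 0), (1, 0, 1, 0)]),
    ((1, 2, 2), (True, False, False), [(-1, 0, 0, 1)]),
    ((1, 2, 2), (False, False, False), [(-1, 0, 0, 0)]),
    ((2, 0, 0), (True, True, True), [(0, 0, 0, 1)]),
    ((2, 0, 0), (False, True, True), [(0, 0, 0, 0)]),
    ((2, 0, 2), (True, True, True), [(1, 0, 1, 0)]),
    ((2, 1, 0), (False, True, True), [(0, 1, 0, 1)]),
    ((2, 1, 1), (True, True, True), [(0, -1, 0, 0), (1, 1, 1, 1)]),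
    ((2, 1, 2), (False, True, False), [(0, 1, 0, 1)]),
    ((2, 2, 0), (False, True, True), [(1, 0, 1, 0)]),
    ((2, 2, 1), (True, False, True), [(0, -1, 0, 0)]),
    ((2, 2, 2), (True, False, True), [])]"

text \<open>The block gives cells to subregions of residue 2 and possibly one to the parent, and no
  cell can be given twice. What remains is tiled together with the cells received.\<close>

fun valid_row :: "(nat \<times> nat \<times> nat) \<times> (bool \<times> bool \<times> bool) \<times> (int \<times> int \<times> int \<times> int) list \<Rightarrow> bool" where
  "valid_row ((i, j, k), (b, c, d), ts) \<longleftrightarrow>
     (let l = Suc (i + j + k);
          Y1 = pick 2 (0, if b then 1 else 0) i;
          Y2 = pick 2 (if c then 0 else 1, 1) j;
          Y3 = pick 2 (if d then 0 else 1, 0) k;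
          Z = pick 1 (1, 0) l
      in Y1 \<inter> Y2 = {} \<and> Y1 \<inter> Y3 = {} \<and> Y2 \<inter> Y3 = {} \<and> Z \<inter> (Y1 \<union> Y2 \<union> Y3) = {} \<and>
         tiles ts (({0, 1} \<times> {0, 1} - (Y1 \<union> Y2 \<union> Y3 \<union> Z)) \<union>
           (pick 1 (-1, if b then 0 else 1) i \<union> pick 1 (if c then 1 else 0, 2) j \<union>
            pick 1 (if d then 1 else 0, -1) k \<union> pick 2 (2, 1) l)))"

lemma valid_table: "list_all valid_row table"
  by code_simp

text \<open>\<open>V\<close> is the block; each \<open>K\<close> hands over its \<open>A\<close> and
  receives its \<open>B\<close>, while \<open>Z\<close> goes to the parent and \<open>Y\<close>
  comes from it. After these exchanges the four pieces are disjoint.\<close>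

lemma has_cover_glue:
  assumes "has_cover (K1 - A1 \<union> B1)" "has_cover (K2 - A2 \<union> B2)" "has_cover (K3 - A3 \<union> B3)"
    and "has_cover (V - (B1 \<union> B2 \<union> B3 \<union> Z) \<union> (A1 \<union> A2 \<union> A3 \<union> Y))"
    and "A1 \<subseteq> K1" "A2 \<subseteq> K2" "A3 \<subseteq> K3"
    and "B1 \<subseteq> V" "B2 \<subseteq> V" "B3 \<subseteq> V" "Z \<subseteq> V"
    and "B1 \<inter> B2 = {}" "B1 \<inter> B3 = {}" "B2 \<inter> B3 = {}" "Z \<inter> (B1 \<union> B2 \<union> B3) = {}"
    and "K1 \<inter> K2 = {}" "K1 \<inter> K3 = {}" "K2 \<inter> K3 = {}" "V \<inter> (K1 \<union> K2 \<union> K3) = {}"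
    and "Y \<inter> (V \<union> K1 \<union> K2 \<union> K3) = {}"
  shows "has_cover ((V \<union> K1 \<union> K2 \<union> K3) - Z \<union> Y)"
proof -
  let ?T = "V - (B1 \<union> B2 \<union> B3 \<union> Z) \<union> (A1 \<union> A2 \<union> A3 \<union> Y)"
  let ?K = "(K1 - A1 \<union> B1) \<union> (K2 - A2 \<union> B2)"
  \<comment> \<open>Instantiated at a single point, the inclusions and disjointness conditions
    become propositional hypotheses for \<open>satx\<close>.\<close>
  note pointwise = assms(5-20)[unfolded disjoint_iff subset_iff Un_iff, THEN spec]
  have "x \<notin> (K1 - A1 \<union> B1) \<inter> (K2 - A2 \<union> B2)" for x
    unfolding Un_iff Int_iff Diff_iff using pointwise[of x] by satx
  then have "has_cover ?K"
    by (intro has_cover_Un[OF assms(1,2)]) blast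
  moreover have "x \<notin> ?K \<inter> (K3 - A3 \<union> B3)" for x
    unfolding Un_iff Int_iff Diff_iff using pointwise[of x] by satx
  ultimately have "has_cover (?K \<union> (K3 - A3 \<union> B3))"
    by (intro has_cover_Un[OF _ assms(3)]) blast+
  moreover have "x \<notin> (?K \<union> (K3 - A3 \<union> B3)) \<inter> ?T" for x
    unfolding Un_iff Int_iff Diff_iff using pointwise[of x] by satx
  ultimately have "has_cover (?K \<union> (K3 - A3 \<union> B3) \<union> ?T)"
    by (intro has_cover_Un[OF _ assms(4)]) blast+
  moreover have "x \<in> ?K \<union> (K3 - A3 \<union> B3) \<union> ?T \<longleftrightarrow> x \<in> (V \<union> K1 \<union> K2 \<union> K3) - Z \<union> Y" for x
    unfolding Un_iff Int_iff Diff_iff using pointwise[of x] by satx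
  then have "?K \<union> (K3 - A3 \<union> B3) \<union> ?T = (V \<union> K1 \<union> K2 \<union> K3) - Z \<union> Y"
    by (rule set_eqI)
  ultimately show ?thesis
    by (simp only:)
qed

lemma pick_mod: "pick k p (n mod 3) = pick k p n"
  by (simp add: pick_def)

lemma fits_from_row:
  assumes "perp e f"
    and row: "((card K1 mod 3, card K2 mod 3, card K3 mod 3), (b, c, d), ts) \<in> set table"
    and "fits K1 (v - e) e (if b then f else - f)"
    and "fits K2 (v + f) (- f) (if c then - e else e)"
    and "fits K3 (v - f) f (if d then - e else e)"
    and fin: "finite K1" "finite K2" "finite K3"
    and disj: "K1 \<inter> K2 = {}" "K1 \<inter> K3 = {}" "K2 \<inter> K3 = {}" "{v, v + e} \<inter> (K1 \<union> K2 \<union> K3) = {}"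
  shows "fits ({v} \<union> K1 \<union> K2 \<union> K3) v e f"
proof -
  let ?q = "loc v e f" and ?S = "{v} \<union> K1 \<union> K2 \<union> K3"
  define A1 A2 A3 where "A1 = pick 1 (-1, if b then 0 else 1) (card K1)"
    and "A2 = pick 1 (if c then 1 else 0, 2) (card K2)"
    and "A3 = pick 1 (if d then 1 else 0, -1) (card K3)"
  define B1 B2 B3 where "B1 = pick 2 (0, if b then 1 else 0) (card K1)"
    and "B2 = pick 2 (if c then 0 else 1, 1) (card K2)"
    and "B3 = pick 2 (if d then 0 else 1, 0) (card K3)"
  define Z Y where "Z = pick 1 (1, 0) (card ?S)" and "Y = pick 2 (2, 1) (card ?S)"
  note defs = A1_def A2_def A3_def B1_def B2_def B3_def Z_def Y_def
  let ?V = "{0, 1} \<times> {0, 1} :: cell set"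
  have "card ?S = Suc (card K1 + card K2 + card K3)"
    using fin disj by (simp add: card_Un_disjoint Int_Un_distrib2)
  then have "card ?S mod 3 = Suc (card K1 mod 3 + card K2 mod 3 + card K3 mod 3) mod 3"
    unfolding Suc_eq_plus1 by (simp only:) (intro mod_add_cong; simp)
  then have S: "pick n p (Suc (card K1 mod 3 + card K2 mod 3 + card K3 mod 3)) = pick n p (card ?S)" for n p
    unfolding pick_def by simp
  have valid: "B1 \<inter> B2 = {}" "B1 \<inter> B3 = {}" "B2 \<inter> B3 = {}" "Z \<inter> (B1 \<union> B2 \<union> B3) = {}"
    "tiles ts (?V - (B1 \<union> B2 \<union> B3 \<union> Z) \<union> (A1 \<union> A2 \<union> A3 \<union> Y))"
    using bspec[OF valid_table[unfolded list_all_iff] row]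
    unfolding valid_row.simps Let_def pick_mod S defs by blast+
  note inj = inj_loc[OF assms(1), of v]
  note im = image_Un[of ?q, symmetric] image_Int[OF inj, symmetric] image_set_diff[OF inj, symmetric]
  have K1: "?q ` A1 \<subseteq> subdivide K1" "has_cover (subdivide K1 - ?q ` A1 \<union> ?q ` B1)"
    using fits_at_back[OF assms(1,3)] unfolding fits_at_def defs by auto
  have K2: "?q ` A2 \<subseteq> subdivide K2" "has_cover (subdivide K2 - ?q ` A2 \<union> ?q ` B2)"
    using fits_at_side[OF assms(1,4)] unfolding fits_at_def defs by auto
  have K3: "?q ` A3 \<subseteq> subdivide K3" "has_cover (subdivide K3 - ?q ` A3 \<union> ?q ` B3)"
    using fits_at_other_side[OF assms(1,5)] unfolding fits_at_def defs by auto
  have sub: "B1 \<subseteq> ?V" "B2 \<subseteq> ?V" "B3 \<subseteq> ?V" "Z \<subseteq> ?V"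
    unfolding defs pick_def by auto
  \<comment> \<open>The cell received from the parent lies in the block of \<open>v + e\<close>,
    which is outside the region.\<close>
  have "?q (2, 1) = loc (v + e) e f (0, 1)"
    by (simp add: loc_add)
  then have "?q (2, 1) \<in> subdivide {v + e}"
    using loc_mem[of e f "(0, 1)" "v + e" "{v + e}"] assms(1) by simp
  moreover have "v + e \<notin> ?S"
    using disj(4) assms(1) by (auto elim: perp_cases simp: prod_eq_iff)
  ultimately have Y: "?q ` Y \<inter> subdivide ?S = {}"
    by (auto simp: Y_def pick_def mem_subdivide)
  have "has_cover (?q ` ?V \<union> subdivide K1 \<union> subdivide K2 \<union> subdivide K3 - ?q ` Z \<union> ?q ` Y)"
  proof (rule has_cover_glue[OF K1(2) K2(2) K3(2)])
    show "has_cover (?q ` ?V - (?q ` B1 \<union> ?q ` B2 \<union> ?q ` B3 \<union> ?q ` Z) \<union> (?q ` A1 \<union> ?q ` A2 \<union> ?q ` A3 \<union> ?q ` Y))"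
      unfolding im by (intro has_cover_loc[OF assms(1)] has_cover_tiles[OF valid(5)])
    show "?q ` ?V \<inter> (subdivide K1 \<union> subdivide K2 \<union> subdivide K3) = {}"
      unfolding loc_block[OF assms(1)] subdivide_Un[symmetric]
      using disj(4) by (intro subdivide_disjoint) auto
    show "?q ` Y \<inter> (?q ` ?V \<union> subdivide K1 \<union> subdivide K2 \<union> subdivide K3) = {}"
      unfolding loc_block[OF assms(1)] subdivide_Un[symmetric] by (rule Y)
    show "?q ` B1 \<inter> ?q ` B2 = {}" "?q ` B1 \<inter> ?q ` B3 = {}" "?q ` B2 \<inter> ?q ` B3 = {}"
      "?q ` Z \<inter> (?q ` B1 \<union> ?q ` B2 \<union> ?q ` B3) = {}"
      unfolding im valid by simp_all
  qed (rule K1(1) K2(1) K3(1) image_mono[OF sub(1)] image_mono[OF sub(2)] image_mono[OF sub(3)]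
      image_mono[OF sub(4)] subdivide_disjoint disj(1-3))+
  then show ?thesis
    unfolding fits_def loc_block[OF assms(1)] subdivide_Un[symmetric] Z_def Y_def by simp
qed

text \<open>The flags say which exchanges are available: both of them for the back, and for a side the one
  whose additional cell borders the parent \<open>v + e\<close> (the other one is always available below).\<close>

definition attachable :: "nat \<Rightarrow> nat \<Rightarrow> nat \<Rightarrow> bool \<Rightarrow> bool \<Rightarrow> bool \<Rightarrow> bool \<Rightarrow> bool" where
  "attachable i j k u l m n \<longleftrightarrow>
     list_ex (\<lambda>((i', j', k'), (b, c, d), ts). i' = i mod 3 \<and> j' = j mod 3 \<and> k' = k mod 3 \<and>
       (if b then u else l) \<and> (c \<or> m) \<and> (d \<or> n)) table"

lemma attachable_mono:
  assumes "attachable i j k u l m n" "u \<longrightarrow> u'" "l \<longrightarrow> l'" "m \<longrightarrow> m'" "n \<longrightarrow> n'"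
  shows "attachable i j k u' l' m' n'"
proof -
  obtain i' j' k' b c d ts where "((i', j', k'), (b, c, d), ts) \<in> set table"
    "i' = i mod 3" "j' = j mod 3" "k' = k mod 3" "if b then u else l" "c \<or> m" "d \<or> n"
    using assms(1) unfolding attachable_def list_ex_iff by auto
  then show ?thesis
    unfolding attachable_def list_ex_iff using assms(2-5)
    by (intro bexI[of _ "((i', j', k'), (b, c, d), ts)"]) auto
qed

text \<open>The second alternative is the mirror image, with the sides and the signs for the back
  swapped. It gives \<open>fits\<close> for \<open>- f\<close>, which \<open>flexible\<close>
  accepts when \<open>v - f\<close> is in the region; \<open>p\<close> records this.\<close>

definition attachable_either :: "nat \<Rightarrow> nat \<Rightarrow> nat \<Rightarrow> bool \<Rightarrow> bool \<Rightarrow> bool \<Rightarrow> bool \<Rightarrow> bool \<Rightarrow> bool" where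
  "attachable_either i j k u l m n p \<longleftrightarrow>
     attachable i j k u l m n \<or> p \<and> attachable i k j l u n m"

text \<open>With neither \<open>u\<close> nor \<open>l\<close> set, all that is known is that one of
  the two exchanges with the back is possible, so both cases must succeed.\<close>

definition robust :: "nat \<Rightarrow> nat \<Rightarrow> nat \<Rightarrow> bool \<Rightarrow> bool \<Rightarrow> bool \<Rightarrow> bool \<Rightarrow> bool \<Rightarrow> bool" where
  "robust i j k u l m n p \<longleftrightarrow>
     (if u \<or> l then attachable_either i j k u l m n p
      else attachable_either i j k True False m n p \<and> attachable_either i j k False True m n p)"

lemma robustD:
  assumes "robust i j k u l m n p" "u \<longrightarrow> u'" "l \<longrightarrow> l'" "u' \<or> l'" "m \<longrightarrow> m'" "n \<longrightarrow> n'"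
  shows "attachable_either i j k u' l' m' n' p"
proof -
  have mono: "attachable_either i j k u' l' m' n' p"
    if "attachable_either i j k u0 l0 m n p" "u0 \<longrightarrow> u'" "l0 \<longrightarrow> l'" for u0 l0
    using that(1) attachable_mono[OF _ that(2,3) assms(5,6)] attachable_mono[OF _ that(3,2) assms(6,5)]
    unfolding attachable_either_def by blast
  show ?thesis
  proof (cases "u \<or> l")
    case True
    then show ?thesis
      using assms(1) mono[OF _ assms(2,3)] by (simp add: robust_def)
  next
    case False
    then have "attachable_either i j k True False m n p" "attachable_either i j k False True m n p"
      using assms(1) by (simp_all add: robust_def)
    then show ?thesis
      using assms(4) mono[of True False] mono[of False True] by blast
  qed
qed

text \<open>Here \<open>x\<close> and \<open>y\<close> are the sizes modulo 3 of the parts behind the two cells diagonal to \<open>v\<close>; each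
  of them joins a side or the back, or forms a coverable region together with both of them.\<close>

lemma distribution_exists:
  "\<forall>p\<in>{True, False}. list_all (\<lambda>a. list_all (\<lambda>b. list_all (\<lambda>c. list_all (\<lambda>x. list_all (\<lambda>y.
     \<not> p \<and> (c \<noteq> 0 \<or> y \<noteq> 0) \<or>
     robust b (a + x) (c + y) p True (x = 0) (y = 0) p \<or>
     robust (b + x) a (c + y) p (x = 0) True (y = 0) p \<or>
     p \<and> robust (b + y) (a + x) c (y = 0) True (x = 0) True p \<or>
     p \<and> robust (b + x + y) a c (y = 0) (x = 0) True True p \<or>
     a = 1 \<and> b = 1 \<and> x = 1 \<and> robust 0 0 (c + y) True True True (y = 0) p \<or>
     p \<and> b = 1 \<and> c = 1 \<and> y = 1 \<and> robust 0 (a + x) 0 True True (x = 0) True p)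
     [0, 1, 2]) [0, 1, 2]) [0, 1, 2]) [0, 1, 2]) [0, 1, 2]"
  by code_simp

text \<open>For a region with no sides: empty sides allow every exchange, and mirror images are
  excluded because both signs have to be obtained.\<close>

lemma robust_side: "list_all (\<lambda>i. robust i 0 0 False False True True False) [0, 1, 2]"
  by code_simp

text \<open>An empty back allows both exchanges, and nothing is assumed about the sides. If
  \<open>v - f\<close> is missing, its subregion is empty.\<close>

lemma robust_no_back:
  "\<forall>p\<in>{True, False}. list_all (\<lambda>j. list_all (\<lambda>k. \<not> p \<and> k \<noteq> 0 \<or> robust 0 j k True True False False p)
     [0, 1, 2]) [0, 1, 2]"
  by code_simp

lemma robust_cong:
  assumes "i mod 3 = i' mod 3" "j mod 3 = j' mod 3" "k mod 3 = k' mod 3"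
  shows "robust i j k = robust i' j' k'"
  using assms by (intro ext) (simp add: robust_def attachable_either_def attachable_def)

lemma mod_3_mem: "n mod 3 \<in> set [0, 1, 2 :: nat]"
  by auto

section \<open>Graded regions\<close>

definition graded :: "cell set \<Rightarrow> (cell \<Rightarrow> nat) \<Rightarrow> bool" where
  "graded S d \<longleftrightarrow> (\<forall>x\<in>S. \<forall>y\<in>S. adjacent x y \<longrightarrow> d x = Suc (d y) \<or> d y = Suc (d x))"

text \<open>Descent stays inside \<open>S\<close>, but \<open>d\<close> is not recomputed for
  \<open>S\<close>: pieces of a region are examined with the depths of the whole.\<close>

definition descending :: "cell set \<Rightarrow> (cell \<Rightarrow> nat) \<Rightarrow> cell \<Rightarrow> bool" where
  "descending S d u \<longleftrightarrow> (\<forall>x\<in>S. x = u \<or> (\<exists>y\<in>S. adjacent x y \<and> d x = Suc (d y)))"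

text \<open>The cells beside the parent are excluded too: a piece hanging from \<open>v + f\<close>
  then cannot contain \<open>v + e + f\<close>, which secures one sign in
  \<open>fits_side\<close>.\<close>

definition rooted :: "cell set \<Rightarrow> (cell \<Rightarrow> nat) \<Rightarrow> cell \<Rightarrow> cell \<Rightarrow> cell \<Rightarrow> bool" where
  "rooted S d v e f \<longleftrightarrow> perp e f \<and> finite S \<and> v \<in> S \<and> {v + e, v + e + f, v + e - f} \<inter> S = {} \<and>
     graded S d \<and> descending S d v"

text \<open>If both \<open>v + f\<close> and \<open>v - f\<close> are in \<open>S\<close>, it is
  left open which sign works; this is the uncertainty that \<open>robust\<close> copes with.\<close>

definition flexible :: "cell set \<Rightarrow> cell \<Rightarrow> cell \<Rightarrow> cell \<Rightarrow> bool" where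
  "flexible S v e f \<longleftrightarrow> fits S v e f \<and> fits S v e (- f) \<or>
     v + f \<in> S \<and> fits S v e f \<or> v - f \<in> S \<and> fits S v e (- f)"

lemma graded_subset: "graded S d \<Longrightarrow> K \<subseteq> S \<Longrightarrow> graded K d"
  unfolding graded_def by blast

lemma adjacent_iff: "perp e f \<Longrightarrow> adjacent x y \<longleftrightarrow> y \<in> {x + e, x - e, x + f, x - f}"
proof -
  have *: "\<bar>a\<bar> + \<bar>b\<bar> = 1 \<longleftrightarrow> a = 0 \<and> (b = 1 \<or> b = - 1) \<or> b = 0 \<and> (a = 1 \<or> a = - 1)" for a b :: int
    by arith
  show "perp e f \<Longrightarrow> ?thesis"
    unfolding adjacent_def * by (erule perp_cases; cases x; cases y; simp; presburger)
qed

lemma adjacent_sym: "adjacent x y = adjacent y x"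
  by (simp add: adjacent_def abs_minus_commute)

lemma descending_above:
  assumes "descending S d u" "x \<in> S"
  shows "u \<in> S \<and> (x = u \<or> d u < d x)"
  using assms(2)
proof (induction "d x" arbitrary: x rule: less_induct)
  case less
  then show ?case
    using assms(1) unfolding descending_def by (metis less_Suc_eq)
qed

lemma descending_empty [simp]: "descending {} d u"
  by (simp add: descending_def)

lemma descending_Un:
  assumes "descending K d u" "descending L d q" "u \<in> K" "adjacent q u" "d q = Suc (d u)"
  shows "descending (K \<union> L) d u"
  using assms unfolding descending_def by auto

text \<open>A piece coverable on its own changes neither the residue nor the exchange. Keeping
  \<open>u + a\<close> out of \<open>L\<close> prevents a clash with the additional cell.\<close>

lemma fits_Un_cover:
  assumes "fits K u a h" "perp a h" "u \<in> K" "finite K" "finite L" "K \<inter> L = {}" "u + a \<notin> L"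
    and "has_cover (subdivide L)" "card L mod 3 = 0"
  shows "fits (K \<union> L) u a h"
proof -
  define A B where "A = loc u a h ` pick 1 (1, 0) (card K)" and "B = loc u a h ` pick 2 (2, 1) (card K)"
  have card: "card (K \<union> L) mod 3 = card K mod 3"
    using assms(4-6,9) by (simp add: card_Un_disjoint mod_add_eq[symmetric])
  have "loc u a h (2, 1) = loc (u + a) a h (0, 1)"
    by (simp add: loc_add)
  then have "B \<subseteq> subdivide {u + a}"
    using loc_mem[of a h "(0, 1)" "u + a" "{u + a}"] assms(2) by (auto simp: B_def pick_def)
  then have B: "B \<inter> subdivide L = {}"
    using assms(7) by (auto simp: mem_subdivide)
  have A: "A \<subseteq> subdivide K"
    using loc_mem[of a h "(1, 0)" u K] assms(2,3) by (auto simp: A_def pick_def)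
  have KL: "subdivide K \<inter> subdivide L = {}"
    using assms(6) by (rule subdivide_disjoint)
  have "has_cover ((subdivide K - A \<union> B) \<union> subdivide L)"
    using assms(1,8) B KL by (intro has_cover_Un[of _ "subdivide L"]) (auto simp: fits_def A_def B_def)
  also have "(subdivide K - A \<union> B) \<union> subdivide L = subdivide (K \<union> L) - A \<union> B"
    using A KL by (auto simp: subdivide_Un)
  finally show ?thesis
    using assms(3) by (simp add: fits_def A_def B_def pick_def card)
qed

text \<open>The tromino around the common corner of the blocks of \<open>v\<close>, \<open>v - e\<close>, \<open>v + f\<close> and \<open>v - e + f\<close> that
  avoids the block of \<open>v\<close>.\<close>

lemma has_cover_three:
  assumes "perp e f" "fits K1 (v - e) e (- f)" "fits K2 (v + f) (- f) e" "fits K3 (v - e + f) (- f) (- e)"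
    and "card K1 mod 3 = 1" "card K2 mod 3 = 1" "card K3 mod 3 = 1"
    and "K1 \<inter> K2 = {}" "K1 \<inter> K3 = {}" "K2 \<inter> K3 = {}"
  shows "has_cover (subdivide (K1 \<union> K2 \<union> K3))"
proof -
  let ?q = "loc v e f"
  have 1: "?q (-1, 1) \<in> subdivide K1" "has_cover (subdivide K1 - {?q (-1, 1)})"
    using fits_at_back[of e f K1 v False] assms(1,2,5) by (auto simp: fits_at_def pick_def)
  have 2: "?q (0, 2) \<in> subdivide K2" "has_cover (subdivide K2 - {?q (0, 2)})"
    using fits_at_side[of e f K2 v False] assms(1,3,6) by (auto simp: fits_at_def pick_def)
  have q: "loc (v - e + f) (- f) (- e) (1, 0) = ?q (-1, 2)"
    using assms(1) by (simp add: loc_minus1 loc_minus2 loc_swap[of _ f] perp_sym[of f] loc_add)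
  have 3: "?q (-1, 2) \<in> subdivide K3" "has_cover (subdivide K3 - {?q (-1, 2)})"
    using assms(1,4,7) loc_mem[of "- f" "- e" "(1, 0)" "v - e + f" K3] q
    by (auto simp: fits_def pick_def perp_sym[of f])
  let ?T = "{?q (-1, 1), ?q (0, 2), ?q (-1, 2)}"
  have "has_cover {(-1, 1), (0, 2), (-1, 2)}"
    by (rule has_cover_tiles[of "[(-1, 1, 1, 0)]"]) (auto simp: block_def)
  then have T: "has_cover ?T"
    using has_cover_loc[OF assms(1), of _ v] by fastforce
  note disj = subdivide_disjoint[OF assms(8)] subdivide_disjoint[OF assms(9)] subdivide_disjoint[OF assms(10)]
  let ?K1 = "subdivide K1 - {?q (-1, 1)}" and ?K2 = "subdivide K2 - {?q (0, 2)}"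
    and ?K3 = "subdivide K3 - {?q (-1, 2)}"
  have "has_cover (?K1 \<union> ?K2)"
    by (rule has_cover_Un[OF 1(2) 2(2)]) (use disj in blast)
  then have "has_cover (?K1 \<union> ?K2 \<union> ?K3)"
    by (rule has_cover_Un[OF _ 3(2)]) (use disj in blast)
  then have "has_cover (?K1 \<union> ?K2 \<union> ?K3 \<union> ?T)"
    by (rule has_cover_Un[OF _ T]) (use disj 1(1) 2(1) 3(1) in blast)
  moreover have "?K1 \<union> ?K2 \<union> ?K3 \<union> ?T = subdivide (K1 \<union> K2 \<union> K3)"
    using 1(1) 2(1) 3(1) by (auto simp: subdivide_Un)
  ultimately show ?thesis
    by simp
qed

section \<open>The induction step\<close>

definition step :: "cell set \<Rightarrow> (cell \<Rightarrow> nat) \<Rightarrow> cell \<Rightarrow> cell \<Rightarrow> cell \<Rightarrow> bool" where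
  "step S d v e f \<longleftrightarrow> rooted S d v e f \<and>
     (\<forall>K u a h. card K < card S \<longrightarrow> rooted K d u a h \<longrightarrow> flexible K u a h)"

lemma rooted_mirror: "rooted S d v e (- f) \<longleftrightarrow> rooted S d v e f"
  by (auto simp: rooted_def)

lemma flexible_mirror: "flexible S v e (- f) \<longleftrightarrow> flexible S v e f"
  by (auto simp: flexible_def)

lemma step_mirror: "step S d v e (- f) \<longleftrightarrow> step S d v e f"
  by (simp add: step_def rooted_mirror)

lemma stepD:
  assumes "step S d v e f"
  shows "perp e f" "finite S" "v \<in> S" "v + e \<notin> S" "v + e + f \<notin> S" "v + e - f \<notin> S"
    "graded S d" "descending S d v"
  using assms by (auto simp: step_def rooted_def)

section \<open>Depths of the cells around the root\<close>

lemma adjacent_steps: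
  assumes "perp e f"
  shows "adjacent v (v + f)" "adjacent v (v - f)" "adjacent v (v - e)"
    "adjacent (v - e) (v - e + f)" "adjacent (v - e) (v - e - f)"
    "adjacent (v + f) (v - e + f)" "adjacent (v - f) (v - e - f)" "adjacent (v - e) (v - e - e)"
  using assms by (auto simp: adjacent_iff algebra_simps)

lemma depth_neighbour:
  assumes "step S d v e f" "x \<in> S" "adjacent v x"
  shows "d x = Suc (d v)"
  using stepD[OF assms(1)] assms(2,3) descending_above[of S d v x]
  unfolding graded_def by fastforce

text \<open>A common neighbour of \<open>v\<close> and the diagonal cell has depth
  \<open>d v + 1\<close>, so the diagonal cell has depth \<open>d v\<close> or
  \<open>d v + 2\<close>. Only the root has depth \<open>d v\<close>, the minimum.\<close>

lemma depth_diagonal: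
  assumes "step S d v e f" "v - e \<in> S \<or> v + f \<in> S" "v - e + f \<in> S"
  shows "d (v - e + f) = Suc (Suc (d v))"
proof -
  note * = stepD[OF assms(1)]
  obtain x where x: "x \<in> S" "adjacent v x" "adjacent x (v - e + f)"
    using assms(2) adjacent_steps[OF *(1)] by blast
  have "v - e + f \<noteq> v"
    using *(1) by (auto elim: perp_cases simp: prod_eq_iff)
  then have "d v < d (v - e + f)"
    using descending_above[OF *(8) assms(3)] by simp
  then show ?thesis
    using depth_neighbour[OF assms(1) x(1,2)] *(7) x assms(3) unfolding graded_def by fastforce
qed

section \<open>Exchanges available to the pieces around the root\<close>

lemma flexible_piece:
  assumes "step S d v e f" "K \<subseteq> S - {v}" "rooted K d u a h"
  shows "flexible K u a h"
proof -
  have "card K < card S"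
    using assms(2) stepD(2,3)[OF assms(1)] by (intro psubset_card_mono) auto
  then show ?thesis
    using assms(1,3) unfolding step_def by blast
qed

text \<open>\<open>flexible\<close> can withhold the sign \<open>- e\<close> only if
  \<open>v + f + e\<close> is in \<open>K\<close>, which \<open>rooted\<close> rules out for
  \<open>S\<close>; it can withhold \<open>e\<close> only if the diagonal cell is in
  \<open>K\<close>.\<close>

lemma fits_side:
  assumes "step S d v e f" "K \<subseteq> S - {v}" "descending K d (v + f)"
  shows "fits K (v + f) (- f) (- e)" "v - e + f \<notin> K \<Longrightarrow> fits K (v + f) (- f) e"
proof -
  note * = stepD[OF assms(1)]
  have "fits K (v + f) (- f) (- e) \<and> (v - e + f \<notin> K \<longrightarrow> fits K (v + f) (- f) e)"
  proof (cases "K = {}")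
    case False
    then have n: "v + f \<in> K"
      using descending_above[OF assms(3)] by blast
    \<comment> \<open>Both cells would have depth \<open>d v + 1\<close>, but besides its root
      \<open>K\<close> has only cells of greater depth than \<open>v + f\<close>.\<close>
    have "v - e \<notin> K"
    proof
      assume w: "v - e \<in> K"
      moreover have "v - e \<noteq> v + f"
        using *(1) by (auto elim: perp_cases simp: prod_eq_iff)
      ultimately show False
        using depth_neighbour[OF assms(1)] adjacent_steps[OF *(1)] descending_above[OF assms(3) w] n assms(2)
        by (metis DiffD1 less_irrefl subsetD)
    qed
    then have "rooted K d (v + f) (- f) e"
      using * n assms(2,3) finite_subset[of K S] graded_subset[of S d K]
      by (auto simp: rooted_def perp_sym[of f])
    then have "flexible K (v + f) (- f) e"
      by (rule flexible_piece[OF assms(1,2)])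
    moreover have "v + f + e \<notin> K" "v + f - e = v - e + f"
      using *(5) assms(2) by (auto simp: algebra_simps)
    ultimately show ?thesis
      by (auto simp: flexible_def)
  qed simp
  then show "fits K (v + f) (- f) (- e)" "v - e + f \<notin> K \<Longrightarrow> fits K (v + f) (- f) e"
    by auto
qed

lemma fits_back:
  assumes "step S d v e f" "K \<subseteq> S - {v}" "descending K d (v - e)"
  shows "fits K (v - e) e f \<or> fits K (v - e) e (- f)"
    "v - e - f \<notin> K \<Longrightarrow> fits K (v - e) e f" "v - e + f \<notin> K \<Longrightarrow> fits K (v - e) e (- f)"
proof -
  note * = stepD[OF assms(1)]
  have "K = {} \<or> flexible K (v - e) e f"
  proof (cases "K = {}")
    case False
    then have w: "v - e \<in> K"
      using descending_above[OF assms(3)] by blast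
    have "x \<notin> K" if "x = v + f \<or> x = v - f" for x
    proof
      assume x: "x \<in> K"
      moreover have "x \<noteq> v - e"
        using that *(1) by (auto elim: perp_cases simp: prod_eq_iff)
      moreover have "adjacent v x"
        using that adjacent_steps[OF *(1)] by blast
      ultimately show False
        using depth_neighbour[OF assms(1)] adjacent_steps[OF *(1)] descending_above[OF assms(3) x] w assms(2)
        by (metis DiffD1 less_irrefl subsetD)
    qed
    then have "rooted K d (v - e) e f"
      using * w assms(2,3) finite_subset[of K S] graded_subset[of S d K]
      by (auto simp: rooted_def)
    then show ?thesis
      using flexible_piece[OF assms(1,2)] by blast
  qed simp
  then show "fits K (v - e) e f \<or> fits K (v - e) e (- f)"
    "v - e - f \<notin> K \<Longrightarrow> fits K (v - e) e f" "v - e + f \<notin> K \<Longrightarrow> fits K (v - e) e (- f)"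
    by (auto simp: flexible_def)
qed

text \<open>The piece is seen as hanging from \<open>v - e\<close>. With the sign
  \<open>- e\<close>, a cell left over is the one at the corner shared with the block of
  \<open>v\<close>, as \<open>has_cover_three\<close> requires.\<close>

lemma fits_diagonal:
  assumes "step S d v e f" "v - e \<in> S" "v + f \<in> S" "K \<subseteq> S - {v}" "descending K d (v - e + f)"
  shows "fits K (v - e + f) (- f) (- e)"
proof (cases "K = {}")
  case False
  note * = stepD[OF assms(1)]
  have q: "v - e + f \<in> K"
    using descending_above[OF assms(5)] False by blast
  then have dq: "d (v - e + f) = Suc (Suc (d v))"
    using depth_diagonal[OF assms(1)] assms(2,4) by blast
  have low: "x \<notin> K" if "x \<noteq> v - e + f" "x \<in> S \<Longrightarrow> d x \<le> Suc (Suc (d v))" for x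
    using that descending_above[OF assms(5), of x] dq assms(4) by force
  have w: "d (v - e) = Suc (d v)"
    using depth_neighbour[OF assms(1,2)] adjacent_steps[OF *(1)] by blast
  have n: "d (v + f) = Suc (d v)"
    using depth_neighbour[OF assms(1,3)] adjacent_steps[OF *(1)] by blast
  have ne: "v - e \<noteq> v - e + f" "v + f \<noteq> v - e + f" "v - e - e \<noteq> v - e + f"
    using *(1) by (auto elim: perp_cases simp: prod_eq_iff)
  \<comment> \<open>As a neighbour of \<open>v - e\<close>, this cell is no deeper than the diagonal
    one, so it cannot descend to it.\<close>
  have "d (v - e - e) \<le> Suc (Suc (d v))" if "v - e - e \<in> S"
    using that *(7) assms(2) w adjacent_steps(8)[OF *(1), of v] unfolding graded_def by fastforce
  then have notin: "v - e \<notin> K" "v + f \<notin> K" "v - e - e \<notin> K"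
    using low ne w n by auto
  then have "rooted K d (v - e + f) (- f) e"
    using * q assms(4,5) finite_subset[of K S] graded_subset[of S d K]
    by (auto simp: rooted_def perp_sym[of f])
  then have "flexible K (v - e + f) (- f) e"
    by (rule flexible_piece[OF assms(1,4)])
  moreover have "v - e + f + e \<notin> K"
    using notin(2) by (simp add: algebra_simps)
  ultimately show ?thesis
    by (auto simp: flexible_def)
qed simp

section \<open>Assembling the root with its three subregions\<close>

lemma fits_root:
  assumes "step S d v e f" "S = {v} \<union> K1 \<union> K2 \<union> K3" "v \<notin> K1 \<union> K2 \<union> K3"
    and "K1 \<inter> K2 = {}" "K1 \<inter> K3 = {}" "K2 \<inter> K3 = {}"
    and "fits K2 (v + f) (- f) (- e)" "fits K3 (v - f) f (- e)"
    and "attachable (card K1) (card K2) (card K3) (fits K1 (v - e) e f) (fits K1 (v - e) e (- f))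
      (fits K2 (v + f) (- f) e) (fits K3 (v - f) f e)"
  shows "fits S v e f"
proof -
  note * = stepD[OF assms(1)]
  obtain b c d ts where row: "((card K1 mod 3, card K2 mod 3, card K3 mod 3), (b, c, d), ts) \<in> set table"
    and "if b then fits K1 (v - e) e f else fits K1 (v - e) e (- f)"
    "c \<or> fits K2 (v + f) (- f) e" "d \<or> fits K3 (v - f) f e"
    using assms(9) unfolding attachable_def list_ex_iff by auto
  then have f1: "fits K1 (v - e) e (if b then f else - f)"
    and f2: "fits K2 (v + f) (- f) (if c then - e else e)"
    and f3: "fits K3 (v - f) f (if d then - e else e)"
    using assms(7,8) by auto
  show ?thesis
    unfolding assms(2)
  proof (rule fits_from_row[OF *(1) row f1 f2 f3])
    show "finite K1" "finite K2" "finite K3"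
      using *(2) by (simp_all add: assms(2))
    show "{v, v + e} \<inter> (K1 \<union> K2 \<union> K3) = {}"
      using *(4) assms(2,3) by blast
  qed fact+
qed

text \<open>The flags are only lower bounds for the exchanges available. In the mirrored
  alternative, \<open>fits_root\<close> is applied to \<open>- f\<close> with \<open>K2\<close> and
  \<open>K3\<close> swapped.\<close>

lemma flexible_root:
  assumes "step S d v e f" "S = {v} \<union> K1 \<union> K2 \<union> K3" "v \<notin> K1 \<union> K2 \<union> K3"
    and "K1 \<inter> K2 = {}" "K1 \<inter> K3 = {}" "K2 \<inter> K3 = {}"
    and "fits K2 (v + f) (- f) (- e)" "fits K3 (v - f) f (- e)" "v + f \<in> S"
    and "robust (card K1) (card K2) (card K3) u l m n p"
    and "u \<Longrightarrow> fits K1 (v - e) e f" "l \<Longrightarrow> fits K1 (v - e) e (- f)"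
    and "fits K1 (v - e) e f \<or> fits K1 (v - e) e (- f)"
    and "m \<Longrightarrow> fits K2 (v + f) (- f) e" "n \<Longrightarrow> fits K3 (v - f) f e" "p \<Longrightarrow> v - f \<in> S"
  shows "flexible S v e f"
proof -
  have "attachable_either (card K1) (card K2) (card K3) (fits K1 (v - e) e f) (fits K1 (v - e) e (- f))
      (fits K2 (v + f) (- f) e) (fits K3 (v - f) f e) p"
    by (rule robustD[OF assms(10)]) (rule impI assms(11-15) | assumption)+
  then consider "attachable (card K1) (card K2) (card K3) (fits K1 (v - e) e f) (fits K1 (v - e) e (- f))
      (fits K2 (v + f) (- f) e) (fits K3 (v - f) f e)"
    | "v - f \<in> S" "attachable (card K1) (card K3) (card K2) (fits K1 (v - e) e (- f)) (fits K1 (v - e) e f)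
      (fits K3 (v - f) f e) (fits K2 (v + f) (- f) e)"
    using assms(16) unfolding attachable_either_def by blast
  then show ?thesis
  proof cases
    case 1
    then have "fits S v e f"
      by (rule fits_root[OF assms(1-8)])
    then show ?thesis
      using assms(9) by (simp add: flexible_def)
  next
    case 2
    have "fits S v e (- f)"
      by (rule fits_root[of S d v e "- f" K1 K3 K2])
        (use assms(1-8) 2(2) in \<open>auto simp: step_mirror\<close>)
    then show ?thesis
      using 2(1) by (simp add: flexible_def)
  qed
qed

section \<open>Cells descending through a given cell\<close>

definition behind :: "cell set \<Rightarrow> (cell \<Rightarrow> nat) \<Rightarrow> cell \<Rightarrow> cell set" where
  "behind S d u = {x \<in> S. (\<lambda>y z. z \<in> S \<and> adjacent y z \<and> d y = Suc (d z))\<^sup>*\<^sup>* x u \<and> u \<in> S}"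

definition upward :: "cell set \<Rightarrow> (cell \<Rightarrow> nat) \<Rightarrow> cell set \<Rightarrow> bool" where
  "upward S d X \<longleftrightarrow> (\<forall>z\<in>X. \<forall>y\<in>S. adjacent y z \<and> d y = Suc (d z) \<longrightarrow> y \<in> X)"

lemma behind_subset: "behind S d u \<subseteq> S"
  by (auto simp: behind_def)

lemma behind_self: "u \<in> S \<Longrightarrow> u \<in> behind S d u"
  by (simp add: behind_def)

lemma behind_outside: "u \<notin> S \<Longrightarrow> behind S d u = {}"
  by (simp add: behind_def)

lemma upward_behind: "upward S d (behind S d u)"
  unfolding upward_def behind_def by (auto intro: converse_rtranclp_into_rtranclp)

lemma upward_Un: "upward S d X \<Longrightarrow> upward S d Y \<Longrightarrow> upward S d (X \<union> Y)"
  unfolding upward_def by blast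

lemma upward_empty: "upward S d {}"
  by (simp add: upward_def)

text \<open>A descending path that enters an upward closed set must have started in it, so the paths
  of the remaining cells survive. Overlapping sets \<open>behind\<close> can thus be made disjoint
  by subtraction.\<close>

lemma descending_behind:
  assumes "upward S d X"
  shows "descending (behind S d u - X) d u"
  unfolding descending_def
proof
  fix x assume x: "x \<in> behind S d u - X"
  let ?r = "\<lambda>y z. z \<in> S \<and> adjacent y z \<and> d y = Suc (d z)"
  have "x \<in> S" "?r\<^sup>*\<^sup>* x u" "u \<in> S" "x \<notin> X"
    using x by (auto simp: behind_def)
  from this(2) show "x = u \<or> (\<exists>y\<in>behind S d u - X. adjacent x y \<and> d x = Suc (d y))"
  proof (cases rule: converse_rtranclpE)
    case (step y)
    then have "y \<in> behind S d u"
      using \<open>u \<in> S\<close> by (simp add: behind_def)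
    moreover have "y \<notin> X"
      using assms step(1) \<open>x \<in> S\<close> \<open>x \<notin> X\<close> unfolding upward_def by blast
    ultimately show ?thesis
      using step(1) by blast
  qed simp
qed

lemma behind_above: "x \<in> behind S d u \<Longrightarrow> x = u \<or> d u < d x"
  using descending_above[OF descending_behind[OF upward_empty], of x S d u] by simp

lemma behind_cover:
  assumes "step S d v e f"
  shows "S - {v} = behind S d (v - e) \<union> behind S d (v + f) \<union> behind S d (v - f)"
proof
  note * = stepD[OF assms]
  have "x \<in> behind S d (v - e) \<union> behind S d (v + f) \<union> behind S d (v - f)" if "x \<in> S" "x \<noteq> v" for x
    using that
  proof (induction "d x" arbitrary: x rule: less_induct)
    case less
    obtain y where y: "y \<in> S" "adjacent x y" "d x = Suc (d y)"
      using *(8) less.prems unfolding descending_def by blast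
    show ?case
    proof (cases "y = v")
      case True
      then have "x \<in> {v + e, v - e, v + f, v - f}"
        using y(2) adjacent_iff[OF *(1)] adjacent_sym by blast
      then show ?thesis
        using *(4) less.prems(1) behind_self[OF less.prems(1)] by auto
    next
      case False
      then have "y \<in> behind S d (v - e) \<union> behind S d (v + f) \<union> behind S d (v - f)"
        using less.hyps[of y] y by simp
      then show ?thesis
        using upward_behind[of S d] y less.prems(1) unfolding upward_def by blast
    qed
  qed
  then show "S - {v} \<subseteq> behind S d (v - e) \<union> behind S d (v + f) \<union> behind S d (v - f)"
    by blast
  have "v \<notin> behind S d u" if "adjacent v u" for u
    using depth_neighbour[OF assms _ that] behind_above[of v S d u] behind_outside[of u S d] that
    by (cases "u \<in> S") (auto simp: adjacent_def)
  then show "behind S d (v - e) \<union> behind S d (v + f) \<union> behind S d (v - f) \<subseteq> S - {v}"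
    using behind_subset adjacent_steps[OF *(1)] by blast
qed

section \<open>Cases by the neighbours of the root\<close>

lemma flexible_no_side:
  assumes "step S d v e f" "v + f \<notin> S" "v - f \<notin> S"
  shows "flexible S v e f"
proof -
  let ?K = "behind S d (v - e)"
  have cover: "S - {v} = ?K"
    using behind_cover[OF assms(1)] assms(2,3) by (simp add: behind_outside)
  have desc: "descending ?K d (v - e)"
    using descending_behind[OF upward_empty] by simp
  have S: "S = {v} \<union> ?K \<union> {} \<union> {}" "v \<notin> ?K \<union> {} \<union> {}"
    using cover stepD(3)[OF assms(1)] by auto
  have fits_K: "fits ?K (v - e) e f \<or> fits ?K (v - e) e (- f)"
    using fits_back(1)[OF assms(1) _ desc] cover by blast
  have "robust (card ?K mod 3) 0 0 False False True True False"
    using robust_side mod_3_mem[of "card ?K"] unfolding list_all_iff by blast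
  then have "robust (card ?K) 0 0 False False True True False"
    by (subst (asm) robust_cong[of _ "card ?K" 0 0 0 0]) simp_all
  \<comment> \<open>Whichever exchange the back allows, some row serves it; used in both mirrored
    frames, this gives both signs.\<close>
  then have *: "attachable (card ?K) 0 0 u l True True" if "u \<or> l" for u l
    using robustD[of "card ?K" 0 0 False False True True False u l True True] that
    by (simp add: attachable_either_def)
  have "fits S v e f"
    by (rule fits_root[OF assms(1) S]) (use fits_K * in auto)
  moreover have "fits S v e (- f)"
    by (rule fits_root[of S d v e "- f", OF _ S]) (use fits_K * assms(1) in \<open>auto simp: step_mirror\<close>)
  ultimately show ?thesis
    by (simp add: flexible_def)
qed

lemma flexible_no_back:
  assumes "step S d v e f" "v - e \<notin> S" "v + f \<in> S"
  shows "flexible S v e f"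
proof -
  let ?K2 = "behind S d (v + f)" and ?K3 = "behind S d (v - f) - behind S d (v + f)"
  have cover: "S - {v} = ?K2 \<union> ?K3"
    using behind_cover[OF assms(1)] assms(2) by (auto simp: behind_outside)
  have S: "S = {v} \<union> {} \<union> ?K2 \<union> ?K3" "v \<notin> {} \<union> ?K2 \<union> ?K3"
    using cover stepD(3)[OF assms(1)] by auto
  have 2: "fits ?K2 (v + f) (- f) (- e)"
    using fits_side(1)[OF assms(1), of ?K2] descending_behind[OF upward_empty] cover by auto
  have 3: "fits ?K3 (v - f) f (- e)"
    using fits_side(1)[of S d v e "- f" ?K3] assms(1) descending_behind[OF upward_behind] cover
    by (auto simp: step_mirror)
  have "card ?K3 mod 3 = 0" if "v - f \<notin> S"
    using that by (simp add: behind_outside)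
  then have "robust 0 (card ?K2 mod 3) (card ?K3 mod 3) True True False False (v - f \<in> S)"
    using robust_no_back[unfolded list_all_iff, rule_format, OF _ mod_3_mem mod_3_mem,
        of "v - f \<in> S" "card ?K3" "card ?K2"]
    by (cases "v - f \<in> S") auto
  then have rob: "robust (card {}) (card ?K2) (card ?K3) True True False False (v - f \<in> S)"
    by (subst (asm) robust_cong[of _ 0 _ "card ?K2" _ "card ?K3"]) simp_all
  show ?thesis
    by (rule flexible_root[OF assms(1) S _ _ _ 2 3 assms(3) rob]) auto
qed

lemma flexible_corner:
  assumes st: "step S d v e f" and w: "v - e \<in> S" and n: "v + f \<in> S"
  shows "flexible S v e f"
proof -
  note * = stepD[OF st]
  have st': "step S d v e (- f)"
    using st by (simp add: step_mirror)
  define q q' s where "q = v - e + f" and "q' = v - e - f" and "s = v - f"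
  define p where "p \<longleftrightarrow> s \<in> S"
  \<comment> \<open>The diagonal \<open>q'\<close> restricts both adjoining pieces only if
    \<open>s\<close> is in \<open>S\<close>; otherwise its cells are left to the other
    pieces.\<close>
  define X Y where "X = behind S d q" and "Y = (if p then behind S d q' else {}) - X"
  define N where "N = behind S d (v + f) - (X \<union> Y)"
  define M where "M = behind S d s - (X \<union> Y \<union> behind S d (v + f))"
  define W where "W = behind S d (v - e) - (X \<union> Y \<union> behind S d (v + f) \<union> behind S d s)"
  have up: "upward S d (X \<union> Y)"
  proof -
    have "X \<union> Y = X \<union> (if p then behind S d q' else {})"
      by (auto simp: Y_def)
    then show ?thesis
      unfolding X_def by (auto intro: upward_Un upward_behind upward_empty)
  qed
  have cover: "S - {v} = W \<union> N \<union> M \<union> X \<union> Y"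
  proof -
    have "X \<union> Y \<subseteq> S - {v}"
    proof -
      have "v \<notin> behind S d u" if "u \<in> S \<Longrightarrow> d v < d u" for u
        using that behind_above[of v S d u] behind_outside[of u S d] by (cases "u \<in> S") auto
      moreover have "d v < d q" if "q \<in> S"
        using depth_diagonal[OF st] w that by (simp add: q_def)
      moreover have "d v < d q'" if "q' \<in> S"
        using depth_diagonal[OF st'] w that by (simp add: q'_def)
      ultimately have "v \<notin> behind S d q" "v \<notin> behind S d q'"
        by blast+
      then show ?thesis
        using behind_subset[of S d q] behind_subset[of S d q'] by (auto simp: X_def Y_def)
    qed
    then show ?thesis
      using behind_cover[OF st] unfolding W_def N_def M_def s_def by blast
  qed
  have disj: "W \<inter> N = {}" "W \<inter> M = {}" "N \<inter> M = {}" "X \<inter> Y = {}"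
    "W \<inter> X = {}" "W \<inter> Y = {}" "N \<inter> X = {}" "N \<inter> Y = {}" "M \<inter> X = {}" "M \<inter> Y = {}"
    by (auto simp: W_def N_def M_def Y_def)
  have fin: "finite W" "finite N" "finite M" "finite X" "finite Y"
    using finite_subset[OF _ *(2)] cover by blast+
  have dw: "d (v - e) = Suc (d v)" and dn: "d (v + f) = Suc (d v)"
    using depth_neighbour[OF st] adjacent_steps[OF *(1)] w n by blast+
  have ds: "d s = Suc (d v)" if p
    using depth_neighbour[OF st] adjacent_steps[OF *(1)] that by (simp add: p_def s_def)
  have dq: "d q = Suc (Suc (d v))" if "q \<in> S"
    using depth_diagonal[OF st] w that by (simp add: q_def)
  have dq': "d q' = Suc (Suc (d v))" if "q' \<in> S"
    using depth_diagonal[OF st'] w that by (simp add: q'_def)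
  have ne: "v - e \<noteq> v + f" "v - e \<noteq> s" "v + f \<noteq> s" "q \<noteq> q'" "v - e \<noteq> q" "v + f \<noteq> q" "s \<noteq> q'"
    "v - e \<noteq> q'" "v + f \<noteq> q'" "s \<noteq> q"
    using *(1) unfolding q_def q'_def s_def by (auto elim: perp_cases simp: prod_eq_iff)
  have low: "x \<notin> behind S d u" if "x \<noteq> u" "u \<in> S \<Longrightarrow> d x \<le> d u" for x u
    using that behind_above[of x S d u] behind_outside[of u S d] by (cases "u \<in> S") auto
  have in_X: "q \<in> S \<Longrightarrow> q \<in> X" and in_Y: "q' \<in> S \<Longrightarrow> p \<Longrightarrow> q' \<in> Y"
    using behind_self low[of q' q] ne dq dq' by (auto simp: X_def Y_def)
  have in_W: "v - e \<in> W" and in_N: "v + f \<in> N" and in_M: "p \<Longrightarrow> s \<in> M"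
    using w n behind_self low ne dw dn ds dq dq' by (auto simp: W_def N_def M_def X_def Y_def p_def)
  have empty: "M = {}" "Y = {}" if "\<not> p"
    using that by (auto simp: M_def Y_def p_def behind_outside)
  have sub: "W \<subseteq> S - {v}" "N \<subseteq> S - {v}" "M \<subseteq> S - {v}" "X \<subseteq> S - {v}" "Y \<subseteq> S - {v}"
    using cover by blast+
  have "q' \<notin> X"
    using low[of q' q] ne(4) dq dq' sub(4) by (cases "q' \<in> S") (auto simp: X_def)
  moreover have "q \<notin> W" "q \<notin> N" "q \<notin> Y"
    using in_X disj(4,5,7) sub by blast+
  moreover have "q' \<notin> W" "q' \<notin> M" if p
    using in_Y[OF _ that] disj(6,10) sub by blast+
  ultimately have q_notin: "q \<notin> W" "q \<notin> N" "q \<notin> Y"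
    and q'_notin: "p \<Longrightarrow> q' \<notin> W" "p \<Longrightarrow> q' \<notin> M" "q' \<notin> X"
    by blast+
  have dW: "descending W d (v - e)"
    unfolding W_def by (rule descending_behind[OF upward_Un[OF upward_Un[OF up upward_behind] upward_behind]])
  have dN: "descending N d (v + f)"
    unfolding N_def by (rule descending_behind[OF up])
  have dM: "descending M d s"
    unfolding M_def by (rule descending_behind[OF upward_Un[OF up upward_behind]])
  have dX: "descending X d q"
    using descending_behind[OF upward_empty] by (simp add: X_def)
  have dY: "descending Y d q'"
    using descending_behind[OF upward_behind] by (simp add: Y_def X_def)
  have adj: "adjacent q (v + f)" "adjacent q (v - e)" "adjacent q' s" "adjacent q' (v - e)"
    using adjacent_steps[OF *(1)] adjacent_sym unfolding q_def q'_def s_def by blast+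
  have X_S: "q \<in> S" if "X \<noteq> {}"
    using that behind_outside[of q S d] by (auto simp: X_def)
  have Y_S: "q' \<in> S" "p" if "Y \<noteq> {}"
    using that behind_outside[of q' S d] by (auto simp: Y_def split: if_splits)
  \<comment> \<open>A diagonal cell borders a side and the back, each at depth one less when
    present, so its piece can join either.\<close>
  have dNX: "descending (N \<union> X) d (v + f)"
    using descending_Un[OF dN dX in_N adj(1)] dq dn dN X_S by (cases "X = {}") auto
  have dWX: "descending (W \<union> X) d (v - e)"
    using descending_Un[OF dW dX in_W adj(2)] dq dw dW X_S by (cases "X = {}") auto
  have dMY: "descending (M \<union> Y) d s"
    using descending_Un[OF dM dY in_M adj(3)] dq' ds dM Y_S by (cases "Y = {}") auto
  have dWY: "descending (W \<union> Y) d (v - e)"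
    using descending_Un[OF dW dY in_W adj(4)] dq' dw dW Y_S by (cases "Y = {}") auto
  have dWXY: "descending (W \<union> X \<union> Y) d (v - e)"
    using descending_Un[OF dWX dY _ adj(4)] in_W dq' dw dWX Y_S by (cases "Y = {}") auto
  have s_simps: "v + - f = s" "v - e + - f = q'" "v - - f = v + f" "v - e - f = q'" "v - e + f = q"
    "v - e - - f = q" "v - f = s"
    by (simp_all add: s_def q_def q'_def)
  note side = fits_side[OF st, unfolded s_simps] and side' = fits_side[OF st', unfolded s_simps minus_minus]
    and bk = fits_back[OF st, unfolded s_simps]
  have fX: "fits X q (- f) (- e)"
    using fits_diagonal[OF st w n sub(4)] dX by (simp add: q_def)
  have fY: "fits Y q' f (- e)"
  proof (cases "Y = {}")
    case False
    then show ?thesis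
      using fits_diagonal[OF st' w _ sub(5)] dY Y_S by (simp add: s_simps p_def)
  qed simp
  have cX: "has_cover (subdivide X)" if "card X mod 3 = 0"
    using fX that by (simp add: fits_def pick_def)
  have cY: "has_cover (subdivide Y)" if "card Y mod 3 = 0"
    using fY that by (simp add: fits_def pick_def)
  have pe: "perp e f" "perp (- f) e" "perp f e" "perp e (- f)"
    using *(1) by (simp_all add: perp_sym[of f])
  have v_notin: "v \<notin> X" "v \<notin> Y"
    using sub by blast+
  have N: "fits N (v + f) (- f) e" "fits N (v + f) (- f) (- e)" "fits (N \<union> X) (v + f) (- f) (- e)"
    using side(1)[OF sub(2) dN] side(2)[OF sub(2) dN q_notin(2)] side(1)[OF _ dNX] sub by blast+
  have NX: "fits (N \<union> X) (v + f) (- f) e" if "card X mod 3 = 0"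
    using fits_Un_cover[OF N(1) pe(2) in_N fin(2,4) disj(7) _ cX[OF that] that] v_notin by simp
  have M: "fits M s f e" "fits M s f (- e)" "fits (M \<union> Y) s f (- e)"
    using side'(1)[OF sub(3) dM] side'(2)[OF sub(3) dM] side'(1)[OF _ dMY] sub q'_notin(2) empty
    by (cases p; simp)+
  have MY: "fits (M \<union> Y) s f e" if "card Y mod 3 = 0"
  proof (cases p)
    case True
    show ?thesis
      using fits_Un_cover[OF M(1) pe(3) in_M[OF True] fin(3,5) disj(10) _ cY[OF that] that] v_notin
      by (simp add: s_def)
  qed (simp add: empty)
  have W: "p \<Longrightarrow> fits W (v - e) e f" "fits W (v - e) e (- f)" "fits W (v - e) e f \<or> fits W (v - e) e (- f)"
    using bk[OF sub(1) dW] q_notin(1) q'_notin(1) by blast+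
  have WX: "p \<Longrightarrow> fits (W \<union> X) (v - e) e f"
    "fits (W \<union> X) (v - e) e f \<or> fits (W \<union> X) (v - e) e (- f)"
    using bk[OF _ dWX] sub q'_notin(1,3) by blast+
  have WX0: "fits (W \<union> X) (v - e) e (- f)" if "card X mod 3 = 0"
    using fits_Un_cover[OF W(2) pe(4) in_W fin(1,4) disj(5) _ cX[OF that] that] v_notin by simp
  have WY: "fits (W \<union> Y) (v - e) e (- f)"
    "fits (W \<union> Y) (v - e) e f \<or> fits (W \<union> Y) (v - e) e (- f)"
    using bk[OF _ dWY] sub q_notin by blast+
  have WY0: "fits (W \<union> Y) (v - e) e f" if "card Y mod 3 = 0" p
    using fits_Un_cover[OF W(1)[OF that(2)] pe(1) in_W fin(1,5) disj(6) _ cY[OF that(1)] that(1)] v_notin by simp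
  have WXY: "fits (W \<union> X \<union> Y) (v - e) e f \<or> fits (W \<union> X \<union> Y) (v - e) e (- f)"
    using bk(1)[OF _ dWXY] sub by blast
  \<comment> \<open>One diagonal piece joins the back through \<open>WX\<close>, and the other one,
    coverable by itself, is absorbed.\<close>
  have WXY_f: "fits (W \<union> X \<union> Y) (v - e) e f" if "card Y mod 3 = 0" p
    using fits_Un_cover[OF WX(1)[OF that(2)] pe(1) _ _ fin(5) _ _ cY[OF that(1)] that(1)]
      in_W fin v_notin disj by (simp add: Int_Un_distrib2)
  have WXY_mf: "fits (W \<union> X \<union> Y) (v - e) e (- f)" if "card X mod 3 = 0"
    using fits_Un_cover[OF WY(1) pe(4) _ _ fin(4) _ _ cX[OF that] that]
      in_W fin v_notin disj by (simp add: Int_Un_distrib Un_ac Int_commute)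
  \<comment> \<open>The union has residue 0, hence no exchange takes place and the sign
    \<open>h\<close> is arbitrary.\<close>
  have J: "fits (W \<union> N \<union> X) (v + f) (- f) h"
    if "card N mod 3 = 1" "card W mod 3 = 1" "card X mod 3 = 1" for h
  proof -
    have "has_cover (subdivide (W \<union> N \<union> X))"
      using has_cover_three[OF pe(1) W(2) N(1) _ that(2,1,3) disj(1,5,7)] fX by (simp add: s_simps)
    moreover have "card (W \<union> N \<union> X) mod 3 = 0"
      using that fin disj by (simp add: card_Un_disjoint Int_Un_distrib2 mod_add_eq[symmetric])
    ultimately show ?thesis
      using in_N by (simp add: fits_def pick_def)
  qed
  have J': "fits (W \<union> M \<union> Y) s f h"
    if "card M mod 3 = 1" "card W mod 3 = 1" "card Y mod 3 = 1" p for h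
  proof -
    have "has_cover (subdivide (W \<union> M \<union> Y))"
      using has_cover_three[OF pe(4) _ _ _ that(2,1,3) disj(2,6,10), of v] W(1)[OF that(4)] M(1) fY
      by (simp add: s_simps)
    moreover have "card (W \<union> M \<union> Y) mod 3 = 0"
      using that fin disj by (simp add: card_Un_disjoint Int_Un_distrib2 mod_add_eq[symmetric])
    ultimately show ?thesis
      using in_M[OF that(4)] by (simp add: fits_def pick_def)
  qed
  have root: "flexible S v e f"
    if "robust i j k u l m t p" "S = {v} \<union> K1 \<union> K2 \<union> K3" "K1 \<inter> K2 = {}" "K1 \<inter> K3 = {}" "K2 \<inter> K3 = {}"
      "i mod 3 = card K1 mod 3" "j mod 3 = card K2 mod 3" "k mod 3 = card K3 mod 3"
      "v \<notin> K1 \<union> K2 \<union> K3" "fits K2 (v + f) (- f) (- e)" "fits K3 s f (- e)"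
      "fits K1 (v - e) e f \<or> fits K1 (v - e) e (- f)"
      "u \<Longrightarrow> fits K1 (v - e) e f" "l \<Longrightarrow> fits K1 (v - e) e (- f)"
      "m \<Longrightarrow> fits K2 (v + f) (- f) e" "t \<Longrightarrow> fits K3 s f e"
    for i j k u l m t K1 K2 K3
  proof (rule flexible_root[OF st that(2,9,3-5,10)])
    show "robust (card K1) (card K2) (card K3) u l m t p"
      using that(1) robust_cong[OF that(6-8)] by simp
  qed (use that n p_def in \<open>simp_all add: s_def\<close>)
  define a b c x y where "a = card N mod 3" and "b = card W mod 3" and "c = card M mod 3"
    and "x = card X mod 3" and "y = card Y mod 3"
  note sizes = a_def b_def c_def x_def y_def
  have mods: "(b + x) mod 3 = card (W \<union> X) mod 3" "(b + y) mod 3 = card (W \<union> Y) mod 3"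
    "(a + x) mod 3 = card (N \<union> X) mod 3" "(c + y) mod 3 = card (M \<union> Y) mod 3"
    "(b + x + y) mod 3 = card (W \<union> X \<union> Y) mod 3"
    "a mod 3 = card N mod 3" "b mod 3 = card W mod 3" "c mod 3 = card M mod 3"
    using fin disj unfolding sizes
    by (simp_all add: card_Un_disjoint Int_Un_distrib2 mod_simps) (intro mod_add_cong; simp add: mod_simps)
  have S: "S = insert v (W \<union> N \<union> M \<union> X \<union> Y)"
    using cover *(3) by blast
  have v: "v \<notin> W" "v \<notin> N" "v \<notin> M" "v \<notin> X" "v \<notin> Y"
    using sub by blast+
  have J0: "0 mod 3 = card (W \<union> N \<union> X) mod 3" if "a = 1" "b = 1" "x = 1"
    using that fin disj unfolding sizes
    by (simp add: card_Un_disjoint Int_Un_distrib2 mod_add_eq[symmetric])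
  have J0': "0 mod 3 = card (W \<union> M \<union> Y) mod 3" if "b = 1" "c = 1" "y = 1"
    using that fin disj unfolding sizes
    by (simp add: card_Un_disjoint Int_Un_distrib2 mod_add_eq[symmetric])
  have "\<not> p \<and> (c \<noteq> 0 \<or> y \<noteq> 0) \<or>
     robust b (a + x) (c + y) p True (x = 0) (y = 0) p \<or>
     robust (b + x) a (c + y) p (x = 0) True (y = 0) p \<or>
     p \<and> robust (b + y) (a + x) c (y = 0) True (x = 0) True p \<or>
     p \<and> robust (b + x + y) a c (y = 0) (x = 0) True True p \<or>
     a = 1 \<and> b = 1 \<and> x = 1 \<and> robust 0 0 (c + y) True True True (y = 0) p \<or>
     p \<and> b = 1 \<and> c = 1 \<and> y = 1 \<and> robust 0 (a + x) 0 True True (x = 0) True p"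
    unfolding sizes
    by (rule distribution_exists[unfolded list_all_iff, rule_format]) (rule mod_3_mem | cases p, simp, simp)+
  moreover have "\<not> (\<not> p \<and> (c \<noteq> 0 \<or> y \<noteq> 0))"
    using empty by (auto simp: sizes)
  \<comment> \<open>In order: both diagonal pieces join their sides; only \<open>X\<close> joins the
    back; only \<open>Y\<close> does; both do; a tromino unites \<open>W\<close>, \<open>N\<close>
    and \<open>X\<close>; a tromino unites \<open>W\<close>, \<open>M\<close> and
    \<open>Y\<close>.\<close>
  ultimately consider "robust b (a + x) (c + y) p True (x = 0) (y = 0) p"
    | "robust (b + x) a (c + y) p (x = 0) True (y = 0) p"
    | "p" "robust (b + y) (a + x) c (y = 0) True (x = 0) True p"
    | "p" "robust (b + x + y) a c (y = 0) (x = 0) True True p"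
    | "a = 1" "b = 1" "x = 1" "robust 0 0 (c + y) True True True (y = 0) p"
    | "p" "b = 1" "c = 1" "y = 1" "robust 0 (a + x) 0 True True (x = 0) True p"
    by blast
  then show ?thesis
  proof cases
    case 1
    show ?thesis
    proof (rule root[OF 1, of "W" "N \<union> X" "M \<union> Y"])
      show "S = {v} \<union> W \<union> (N \<union> X) \<union> (M \<union> Y)" "v \<notin> W \<union> (N \<union> X) \<union> (M \<union> Y)"
        using S v by blast+
      show "W \<inter> (N \<union> X) = {}" "W \<inter> (M \<union> Y) = {}" "(N \<union> X) \<inter> (M \<union> Y) = {}"
        using disj by (simp_all add: Int_Un_distrib Int_Un_distrib2 Int_commute)
    qed (rule mods N M W NX[folded x_def] MY[folded y_def] | assumption | simp)+
  next
    case 2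
    show ?thesis
    proof (rule root[OF 2, of "W \<union> X" "N" "M \<union> Y"])
      show "S = {v} \<union> (W \<union> X) \<union> N \<union> (M \<union> Y)" "v \<notin> (W \<union> X) \<union> N \<union> (M \<union> Y)"
        using S v by blast+
      show "(W \<union> X) \<inter> N = {}" "(W \<union> X) \<inter> (M \<union> Y) = {}" "N \<inter> (M \<union> Y) = {}"
        using disj by (simp_all add: Int_Un_distrib Int_Un_distrib2 Int_commute)
    qed (rule mods N M WX WX0[folded x_def] MY[folded y_def] | assumption | simp)+
  next
    case 3
    show ?thesis
    proof (rule root[OF 3(2), of "W \<union> Y" "N \<union> X" "M"])
      show "S = {v} \<union> (W \<union> Y) \<union> (N \<union> X) \<union> M" "v \<notin> (W \<union> Y) \<union> (N \<union> X) \<union> M"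
        using S v by blast+
      show "(W \<union> Y) \<inter> (N \<union> X) = {}" "(W \<union> Y) \<inter> M = {}" "(N \<union> X) \<inter> M = {}"
        using disj by (simp_all add: Int_Un_distrib Int_Un_distrib2 Int_commute)
    qed (rule mods N M WY WY0[folded y_def, OF _ 3(1)] NX[folded x_def] | assumption | simp)+
  next
    case 4
    show ?thesis
    proof (rule root[OF 4(2), of "W \<union> X \<union> Y" "N" "M"])
      show "S = {v} \<union> (W \<union> X \<union> Y) \<union> N \<union> M" "v \<notin> (W \<union> X \<union> Y) \<union> N \<union> M"
        using S v by blast+
      show "(W \<union> X \<union> Y) \<inter> N = {}" "(W \<union> X \<union> Y) \<inter> M = {}" "N \<inter> M = {}"
        using disj by (simp_all add: Int_Un_distrib Int_Un_distrib2 Int_commute)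
    qed (rule mods N M WXY WXY_f[folded y_def, OF _ 4(1)] WXY_mf[folded x_def] | assumption | simp)+
  next
    case 5
    show ?thesis
    proof (rule root[OF 5(4), of "{}" "W \<union> N \<union> X" "M \<union> Y"])
      show "S = {v} \<union> {} \<union> (W \<union> N \<union> X) \<union> (M \<union> Y)" "v \<notin> {} \<union> (W \<union> N \<union> X) \<union> (M \<union> Y)"
        using S v by blast+
      show "{} \<inter> (W \<union> N \<union> X) = {}" "{} \<inter> (M \<union> Y) = {}" "(W \<union> N \<union> X) \<inter> (M \<union> Y) = {}"
        using disj by (simp_all add: Int_Un_distrib Int_Un_distrib2 Int_commute)
    qed (rule mods J0[OF 5(1-3)] J[folded sizes, OF 5(1-3)] M MY[folded y_def] | assumption | simp)+
  next
    case 6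
    show ?thesis
    proof (rule root[OF 6(5), of "{}" "N \<union> X" "W \<union> M \<union> Y"])
      show "S = {v} \<union> {} \<union> (N \<union> X) \<union> (W \<union> M \<union> Y)" "v \<notin> {} \<union> (N \<union> X) \<union> (W \<union> M \<union> Y)"
        using S v by blast+
      show "{} \<inter> (N \<union> X) = {}" "{} \<inter> (W \<union> M \<union> Y) = {}" "(N \<union> X) \<inter> (W \<union> M \<union> Y) = {}"
        using disj by (simp_all add: Int_Un_distrib Int_Un_distrib2 Int_commute)
    qed (rule mods J0'[OF 6(2-4)] J'[folded sizes, OF 6(3,2,4,1)] N NX[folded x_def] | assumption | simp)+
  qed
qed

text \<open>Up to mirroring, either both sides are missing, or \<open>v + f\<close> is present, with
  or without a back.\<close>

lemma rooted_imp_flexible: "rooted S d v e f \<Longrightarrow> flexible S v e f"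
proof (induction "card S" arbitrary: S v e f rule: less_induct)
  case less
  have st: "step S d v e f"
    using less unfolding step_def by blast
  show ?case
    using flexible_corner[OF st] flexible_no_back[OF st] flexible_no_side[OF st]
      flexible_corner[of S d v e "- f"] flexible_no_back[of S d v e "- f"] st
    by (auto simp: step_mirror flexible_mirror)
qed

section \<open>Distance from a cell\<close>

lemma region_grading:
  assumes "region R" "r \<in> R"
  obtains d where "graded R d" "descending R d r"
proof -
  let ?r = "\<lambda>x y. x \<in> R \<and> y \<in> R \<and> adjacent x y"
  define d where "d x = (LEAST k. (?r ^^ k) r x)" for x
  have path: "(?r ^^ d x) r x" if "x \<in> R" for x
  proof -
    have "?r\<^sup>*\<^sup>* r x"
      using assms that by (simp add: region_def)
    then show ?thesis
      unfolding d_def rtranclp_power by (rule LeastI_ex)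
  qed
  have d_le: "d x \<le> k" if "(?r ^^ k) r x" for k x
    unfolding d_def using that by (rule Least_le)
  \<comment> \<open>By the checkerboard colouring, the ends of a path determine its length modulo 2,
    so adjacent cells have different distances.\<close>
  have parity: "even (int k + fst r + snd r + fst x + snd x)" if "(?r ^^ k) r x" for k x
    using that
  proof (induction k arbitrary: x)
    case (Suc k)
    then obtain y where "(?r ^^ k) r y" "adjacent y x"
      by auto
    then show ?case
      using Suc.IH[of y] adjacent_iff[of "(1, 0)" "(0, 1)" y x] by (auto simp: perp_def)
  qed simp
  have near: "d y \<le> Suc (d x)" if "x \<in> R" "y \<in> R" "adjacent x y" for x y
    using that path[of x] by (intro d_le) auto
  have "d x = Suc (d y) \<or> d y = Suc (d x)" if "x \<in> R" "y \<in> R" "adjacent x y" for x y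
  proof -
    have "d y \<le> Suc (d x)" "d x \<le> Suc (d y)"
      using near that adjacent_sym by blast+
    moreover have "d x \<noteq> d y"
      using parity[OF path[OF that(1)]] parity[OF path[OF that(2)]] that(3)
        adjacent_iff[of "(1, 0)" "(0, 1)" x y] by (auto simp: perp_def)
    ultimately show ?thesis
      by linarith
  qed
  then have "graded R d"
    by (simp add: graded_def)
  moreover have "descending R d r"
    unfolding descending_def
  proof
    fix x assume x: "x \<in> R"
    show "x = r \<or> (\<exists>y\<in>R. adjacent x y \<and> d x = Suc (d y))"
    proof (cases "d x")
      case 0
      then show ?thesis
        using path[OF x] by simp
    next
      case (Suc k)
      then obtain y where y: "(?r ^^ k) r y" "y \<in> R" "adjacent y x"
        using path[OF x] by auto
      then have "d x = Suc (d y)"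
        using d_le[OF y(1)] near[OF y(2) x y(3)] Suc by simp
      then show ?thesis
        using y adjacent_sym by blast
    qed
  qed
  ultimately show ?thesis
    by (rule that)
qed

lemma region_has_cover:
  assumes "region R" "3 dvd card R"
  shows "has_cover (subdivide R)"
proof (cases "R = {}")
  case False
  have fin: "finite R"
    using assms(1) by (simp add: region_def)
  then have "Min (fst ` R) \<in> fst ` R"
    using False by (intro Min_in) auto
  then obtain r where "r \<in> R" "fst r = Min (fst ` R)"
    by auto
  then have r: "r \<in> R" "\<And>x. x \<in> R \<Longrightarrow> fst r \<le> fst x"
    using fin by simp_all
  obtain d where d: "graded R d" "descending R d r"
    using region_grading[OF assms(1) r(1)] .
  \<comment> \<open>The column left of a leftmost cell is empty, so the parent and both cells beside
    it are outside \<open>R\<close>.\<close>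
  have "x \<notin> R" if "fst x = fst r - 1" for x
    using r(2)[of x] that by auto
  then have "rooted R d r (-1, 0) (0, 1)"
    using d r(1) fin by (simp add: rooted_def perp_def)
  then have "flexible R r (-1, 0) (0, 1)"
    by (rule rooted_imp_flexible)
  \<comment> \<open>With the size divisible by 3 no cell is exchanged, so every alternative in
    \<open>flexible\<close> gives an exact cover.\<close>
  then show ?thesis
    using assms(2) by (auto simp: flexible_def fits_def pick_def dvd_eq_mod_eq_0)
qed simp

theorem theorem7:
  fixes R :: "cell set" and n :: nat
  assumes "region R" and "card R = n"
  shows "has_cover (subdivide R) \<longleftrightarrow> 3 dvd n"
proof
  assume "has_cover (subdivide R)"
  moreover have "finite R"
    using assms(1) by (simp add: region_def)
  \<comment> \<open>The subdivision has \<open>4 * n\<close> cells, and 4 is coprime to 3.\<close>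
  ultimately have "3 dvd 4 * n"
    using has_cover_dvd_card card_subdivide assms(2) by metis
  then show "3 dvd n"
    by presburger
next
  assume "3 dvd n"
  then show "has_cover (subdivide R)"
    using region_has_cover assms by simp
qed

end
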